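(* The tableau calculus $\mathbf{TAB}_{\mathbf{PO}}$ has the termination property; that is, for every formula $\varphi$ and every nominal $i$ not occurring in $\varphi$, every tableau in $\mathbf{TAB}_{\mathbf{PO}}$ with root formula $@_i\varphi$ is finite.
   Context: **Formulas.** Let $\mathbf{Prop}$ (propositional variables) and $\mathbf{Nom}$ (nominals) be disjoint countably infinite sets. Formulas are $\varphi ::= p \mid i \mid \neg\varphi \mid \varphi\land\varphi \mid \varphi\lor\varphi \mid \Diamond\varphi \mid \Box\varphi \mid @_i\varphi$ with $p\in\mathbf{Prop}$, $i\in\mathbf{Nom}$. All formulas are taken in negation normal form (NNF: negation only in front of propositional variables and nominals; $\neg @_i\varphi$ is rewritten as $@_i\neg\varphi$, Boolean and modal operators as usual), and $\neg\varphi$ denotes the NNF of the negation of $\varphi$. **Tableaus.** A tableau is a tree of formulas, built downwards from a root formula $@_i\varphi$, where $i\in\mathbf{Nom}$ does not occur in $\varphi$, by extending branches with the rules below (branches may a priori be infinite). We write $\varphi\in\Theta$ if $\varphi$ occurs in the branch $\Theta$. A branch $\Theta$ is closed if $@_i\varphi, @_i\neg\varphi\in\Theta$ for some $\varphi$, $i$; otherwise it is open. A closed branch is not extended, nor is a branch on which every formula that could be generated by applying a rule already exists; rules are not applied redundantly: each application must add a formula not already on the branch to every branch it produces. **Rules of $\mathbf{TAB}_{\mathbf{PO}}$** (premises are on the branch; conclusions are added to it). "Accessibility formula" means a formula $@_i\Diamond j$ added by $[\Diamond]$ (with $j$ new) or a formula $@_i\Diamond i$ added by $[Ref]$. - $[Eq]$: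 add $@_i i$, for any nominal $i$ already occurring in the branch. - $[\land]$: from $@_i(\varphi\land\psi)$ add $@_i\varphi$ and $@_i\psi$. - $[\lor]$: from $@_i(\varphi\lor\psi)$ split the branch, adding $@_i\varphi$ on one side and $@_i\psi$ on the other. - $[\Diamond]$: from $@_i\Diamond\varphi$ which is not an accessibility formula, add $@_i\Diamond j$ and $@_j\varphi$, where $j$ is a nominal not occurring in the branch; it is applied at most once per formula. - $[\Box]$: from $@_i\Box\varphi$ and $@_i\Diamond j$ add $@_j\varphi$. - $[@]$: from $@_i@_j\varphi$ add $@_j\varphi$. - $[Id]$: from $@_i\varphi$, not an accessibility formula, and $@_i j$ add $@_j\varphi$. - $[Ref]$: add $@_i\Diamond i$, for any nominal $i$ already occurring in the branch. - $[A\text{-}sym]$: add $@_i\Box(i\lor\Box\neg i)$, for any nominal $i$ already occurring in the branch. - $[Trs]$: from $@_i\Box\varphi$ and $@_i\Diamond j$ add $@_j\Box\varphi$. - Restriction $(\mathcal D)$: $[\Diamond]$ can be applied to $@_i\Diamond\varphi$ on a branch $\Theta$ only if $i$ is a quasi-urfather on $\Theta$ (at the moment of application). **Quasi-urfathers.** $@_i\varphi$ is a prefixed subformula of $@_j\psi$ if $\varphi$ is a subformula of $\psi$. For a nominal $i$ occurring in $\Theta$, $T^\Theta(i)=T_1^\Theta(i)\cup T_2^\Theta(i)$, where $T_1^\Theta(i)$ is the set of $\varphi$ such that $@_i\varphi\in\Theta$ is a prefixed subformula of the root formula of $\Theta$, and $T_2^\Theta(i)$ is the set of $\psi$ such that $@_i\psi\in\Theta$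 is a prefixed subformula of $@_j\Box(j\lor\Box\neg j)$ for some $j$ occurring in the root formula. Nominals $i,j$ are twins in $\Theta$ if $T^\Theta(i)=T^\Theta(j)$. Write $i\prec_\Theta j$ if $j$ is introduced in $\Theta$ by applying $[\Diamond]$ to some $@_i\Diamond\varphi$; $\prec_\Theta^*$ is the reflexive transitive closure. A nominal $i$ is a quasi-urfather on $\Theta$ if there are no twins $j\neq k$ with $j\prec_\Theta^* i$ and $k\prec_\Theta^* i$. *)

theory Defs
  imports Main
begin

text \<open>Propositional variables and nominals are two disjoint copies of the natural numbers;
  disjointness comes from the constructors \<open>Pro\<close> and \<open>Nom\<close>.\<close>

type_synonym nom = nat

datatype fm =
    Pro nat
  | Nom nom
  | Neg fm
  | Con fm fm
  | Dis fm fm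
  | Dia fm
  | Box fm
  | At nom fm

fun nnf :: "fm \<Rightarrow> fm" where
  "nnf (Pro p) = Pro p"
| "nnf (Nom i) = Nom i"
| "nnf (Con f g) = Con (nnf f) (nnf g)"
| "nnf (Dis f g) = Dis (nnf f) (nnf g)"
| "nnf (Dia f) = Dia (nnf f)"
| "nnf (Box f) = Box (nnf f)"
| "nnf (At i f) = At i (nnf f)"
| "nnf (Neg (Pro p)) = Neg (Pro p)"
| "nnf (Neg (Nom i)) = Neg (Nom i)"
| "nnf (Neg (Neg f)) = nnf f"
| "nnf (Neg (Con f g)) = Dis (nnf (Neg f)) (nnf (Neg g))"
| "nnf (Neg (Dis f g)) = Con (nnf (Neg f)) (nnf (Neg g))"
| "nnf (Neg (Dia f)) = Box (nnf (Neg f))"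
| "nnf (Neg (Box f)) = Dia (nnf (Neg f))"
| "nnf (Neg (At i f)) = At i (nnf (Neg f))"

primrec noms :: "fm \<Rightarrow> nom set" where
  "noms (Pro p) = {}"
| "noms (Nom i) = {i}"
| "noms (Neg f) = noms f"
| "noms (Con f g) = noms f \<union> noms g"
| "noms (Dis f g) = noms f \<union> noms g"
| "noms (Dia f) = noms f"
| "noms (Box f) = noms f"
| "noms (At i f) = insert i (noms f)"

primrec subfms :: "fm \<Rightarrow> fm set" where
  "subfms (Pro p) = {Pro p}"
| "subfms (Nom i) = {Nom i}"
| "subfms (Neg f) = insert (Neg f) (subfms f)"
| "subfms (Con f g) = insert (Con f g) (subfms f \<union> subfms g)"
| "subfms (Dis f g) = insert (Dis f g) (subfms f \<union> subfms g)"
| "subfms (Dia f) = insert (Dia f) (subfms f)"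
| "subfms (Box f) = insert (Box f) (subfms f)"
| "subfms (At i f) = insert (At i f) (subfms f)"

definition prefixed_subfm :: "fm \<Rightarrow> fm \<Rightarrow> bool" where
  "prefixed_subfm f g \<longleftrightarrow>
     (\<exists>i \<phi> j \<psi>. f = At i \<phi> \<and> g = At j \<psi> \<and> \<phi> \<in> subfms \<psi>)"

text \<open>The antisymmetry formula \<open>\<box>(i \<or> \<box>\<not>i)\<close>.\<close>

definition antisym_fm :: "nom \<Rightarrow> fm" where
  "antisym_fm i = Box (Dis (Nom i) (Box (Neg (Nom i))))"


text \<open>Being an accessibility formula, the relation \<open>\<prec>\<close> and the restriction to one application of
  the diamond rule per formula depend on how formulas entered the branch.  Each node of a
  tableau therefore records, besides its formula, whether it is a conclusion of the reflexivity
  rule, a conclusion of the diamond rule (\<open>By_Dia f j\<close>: premise \<open>f\<close>, new nominal \<open>j\<close>), or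
  anything else.  A branch is listed from the root downwards.\<close>

datatype origin = By_Dia fm nom | By_Ref | Other

type_synonym entry = "fm \<times> origin"
type_synonym branch = "entry list"

definition fms :: "branch \<Rightarrow> fm set" where
  "fms \<Theta> = fst ` set \<Theta>"

definition root_fm :: "branch \<Rightarrow> fm" where
  "root_fm \<Theta> = fst (hd \<Theta>)"

definition branch_noms :: "branch \<Rightarrow> nom set" where
  "branch_noms \<Theta> = (\<Union>f \<in> fms \<Theta>. noms f)"

definition closed_branch :: "branch \<Rightarrow> bool" where
  "closed_branch \<Theta> \<longleftrightarrow> (\<exists>i \<phi>. At i \<phi> \<in> fms \<Theta> \<and> At i (nnf (Neg \<phi>)) \<in> fms \<Theta>)"

text \<open>The second disjunct is the case of \<open>@\<^sub>i\<diamond>i\<close> added by reflexivity.  In the first, the origin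
  \<open>By_Dia g j\<close> says that this very \<open>j\<close> is the nominal created by the application.\<close>

definition accessibility :: "branch \<Rightarrow> fm \<Rightarrow> bool" where
  "accessibility \<Theta> f \<longleftrightarrow>
     (\<exists>i j g. f = At i (Dia (Nom j)) \<and> (f, By_Dia g j) \<in> set \<Theta>) \<or>
     (\<exists>i. f = At i (Dia (Nom i)) \<and> (f, By_Ref) \<in> set \<Theta>)"

definition dia_applied :: "branch \<Rightarrow> fm \<Rightarrow> bool" where
  "dia_applied \<Theta> f \<longleftrightarrow> (\<exists>g j. (g, By_Dia f j) \<in> set \<Theta>)"

definition introduces :: "branch \<Rightarrow> nom \<Rightarrow> nom \<Rightarrow> bool" where
  "introduces \<Theta> i j \<longleftrightarrow> (\<exists>g \<phi>. (g, By_Dia (At i (Dia \<phi>)) j) \<in> set \<Theta>)"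

definition T1 :: "branch \<Rightarrow> nom \<Rightarrow> fm set" where
  "T1 \<Theta> i = {\<phi>. At i \<phi> \<in> fms \<Theta> \<and> prefixed_subfm (At i \<phi>) (root_fm \<Theta>)}"

definition T2 :: "branch \<Rightarrow> nom \<Rightarrow> fm set" where
  "T2 \<Theta> i = {\<psi>. At i \<psi> \<in> fms \<Theta> \<and>
     (\<exists>j \<in> noms (root_fm \<Theta>). prefixed_subfm (At i \<psi>) (At j (antisym_fm j)))}"

definition T_set :: "branch \<Rightarrow> nom \<Rightarrow> fm set" where
  "T_set \<Theta> i = T1 \<Theta> i \<union> T2 \<Theta> i"

definition twins :: "branch \<Rightarrow> nom \<Rightarrow> nom \<Rightarrow> bool" where
  "twins \<Theta> i j \<longleftrightarrow> T_set \<Theta> i = T_set \<Theta> j"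

definition quasi_urfather :: "branch \<Rightarrow> nom \<Rightarrow> bool" where
  "quasi_urfather \<Theta> i \<longleftrightarrow>
     \<not> (\<exists>j k. j \<noteq> k \<and> twins \<Theta> j k \<and> (introduces \<Theta>)\<^sup>*\<^sup>* j i \<and> (introduces \<Theta>)\<^sup>*\<^sup>* k i)"


text \<open>\<open>rule \<Theta> bs\<close>: some rule is applicable to \<open>\<Theta>\<close> and extends it, one copy for each member of \<open>bs\<close>,
  by the nodes listed in that member.\<close>

inductive rule :: "branch \<Rightarrow> branch list \<Rightarrow> bool" where
  Eq: "i \<in> branch_noms \<Theta> \<Longrightarrow> rule \<Theta> [[(At i (Nom i), Other)]]"
| And: "At i (Con \<phi> \<psi>) \<in> fms \<Theta> \<Longrightarrow> rule \<Theta> [[(At i \<phi>, Other), (At i \<psi>, Other)]]"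
| Or: "At i (Dis \<phi> \<psi>) \<in> fms \<Theta> \<Longrightarrow> rule \<Theta> [[(At i \<phi>, Other)], [(At i \<psi>, Other)]]"
| Diamond: "At i (Dia \<phi>) \<in> fms \<Theta> \<Longrightarrow> \<not> accessibility \<Theta> (At i (Dia \<phi>)) \<Longrightarrow>
    \<not> dia_applied \<Theta> (At i (Dia \<phi>)) \<Longrightarrow> quasi_urfather \<Theta> i \<Longrightarrow> j \<notin> branch_noms \<Theta> \<Longrightarrow>
    rule \<Theta> [[(At i (Dia (Nom j)), By_Dia (At i (Dia \<phi>)) j), (At j \<phi>, By_Dia (At i (Dia \<phi>)) j)]]"
| Square: "At i (Box \<phi>) \<in> fms \<Theta> \<Longrightarrow> At i (Dia (Nom j)) \<in> fms \<Theta> \<Longrightarrow>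
    rule \<Theta> [[(At j \<phi>, Other)]]"
| Satisfaction: "At i (At j \<phi>) \<in> fms \<Theta> \<Longrightarrow> rule \<Theta> [[(At j \<phi>, Other)]]"
| Id: "At i \<phi> \<in> fms \<Theta> \<Longrightarrow> \<not> accessibility \<Theta> (At i \<phi>) \<Longrightarrow> At i (Nom j) \<in> fms \<Theta> \<Longrightarrow>
    rule \<Theta> [[(At j \<phi>, Other)]]"
| Ref: "i \<in> branch_noms \<Theta> \<Longrightarrow> rule \<Theta> [[(At i (Dia (Nom i)), By_Ref)]]"
| A_sym: "i \<in> branch_noms \<Theta> \<Longrightarrow> rule \<Theta> [[(At i (antisym_fm i), Other)]]"
| Trs: "At i (Box \<phi>) \<in> fms \<Theta> \<Longrightarrow> At i (Dia (Nom j)) \<in> fms \<Theta> \<Longrightarrow>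
    rule \<Theta> [[(At j (Box \<phi>), Other)]]"

text \<open>A closed branch is not extended, and every branch produced must gain a formula.  The latter
  also stops the extension of a branch on which all generable formulas already occur.\<close>

definition step :: "branch \<Rightarrow> branch list \<Rightarrow> bool" where
  "step \<Theta> bs \<longleftrightarrow> rule \<Theta> bs \<and> \<not> closed_branch \<Theta> \<and> (\<forall>b \<in> set bs. \<not> fms b \<subseteq> fms \<Theta>)"


codatatype 'a tree = Node (label: 'a) (children: "'a tree list")

primrec is_node :: "nat list \<Rightarrow> 'a tree \<Rightarrow> bool" where
  "is_node [] t \<longleftrightarrow> True"
| "is_node (n # p) t \<longleftrightarrow> n < length (children t) \<and> is_node p (children t ! n)"

text \<open>Nodes are identified with their addresses, i.e. lists of child indices read from the root.\<close>

definition nodes :: "'a tree \<Rightarrow> nat list set" where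
  "nodes t = {p. is_node p t}"

primrec thread :: "'a list \<Rightarrow> 'a tree list \<Rightarrow> 'a tree list" where
  "thread [] ts = ts"
| "thread (x # xs) ts = [Node x (thread xs ts)]"

text \<open>\<open>extension \<Theta> ts\<close>: \<open>ts\<close> are the trees hanging below the last node of the branch \<open>\<Theta>\<close>.  Either
  nothing does, or a rule application puts a thread of one or two new nodes per resulting
  branch, under which that branch is extended further.  The definition is coinductive, so
  infinite tableaus are admitted, as are tableaus that are not saturated.\<close>

coinductive extension :: "branch \<Rightarrow> entry tree list \<Rightarrow> bool" where
  Stop: "extension \<Theta> []"
| Extend: "step \<Theta> bs \<Longrightarrow> list_all2 (\<lambda>b us. extension (\<Theta> @ b) us) bs uss \<Longrightarrow>
    extension \<Theta> (concat (map2 thread bs uss))"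
monos list.rel_mono_strong

definition tableau :: "fm \<Rightarrow> entry tree \<Rightarrow> bool" where
  "tableau f t \<longleftrightarrow> label t = (f, Other) \<and> extension [label t] (children t)"

end

theory Submission imports Defs begin

text \<open>A nominal introduced by the diamond rule is addressed by the nominal of the root formula from
  which it descends, together with the list of diamond bodies used on the way.  The diamond rule is
  applied at most once per formula, so addresses are unique; it is applied only at
  quasi-urfathers, whose ancestors have pairwise different sets \<open>T\<close>, and these sets are drawn from
  a finite set depending only on the root, so addresses have bounded length.  Hence
  the number of nominals, and with it the number of formulas, on a branch is bounded in
  terms of the root formula, while every rule application adds a formula.\<close>

section \<open>Subformulas, nominals, and branches that arise in a tableau\<close>

lemma subfms_refl [simp]: "f \<in> subfms f"
  by (cases f) auto

lemma subfms_trans: "f \<in> subfms g \<Longrightarrow> g \<in> subfms h \<Longrightarrow> f \<in> subfms h"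
  by (induction h) auto

lemma finite_subfms [simp]: "finite (subfms f)"
  by (induction f) auto

lemma finite_noms [simp]: "finite (noms f)"
  by (induction f) auto

lemma noms_antisym_fm [simp]: "noms (antisym_fm i) = {i}"
  by (simp add: antisym_fm_def)

lemma subfms_antisym_fm:
  "subfms (antisym_fm i) =
     {antisym_fm i, Dis (Nom i) (Box (Neg (Nom i))), Nom i, Box (Neg (Nom i)), Neg (Nom i)}"
  by (auto simp: antisym_fm_def)

lemma fms_append [simp]: "fms (\<Theta> @ b) = fms \<Theta> \<union> fms b"
  by (auto simp: fms_def)

lemma finite_fms [simp]: "finite (fms \<Theta>)"
  by (simp add: fms_def)

lemma branch_noms_append [simp]: "branch_noms (\<Theta> @ b) = branch_noms \<Theta> \<union> branch_noms b"
  by (auto simp: branch_noms_def)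

lemma finite_branch_noms [simp]: "finite (branch_noms \<Theta>)"
  by (simp add: branch_noms_def)

lemma noms_branch: "f \<in> fms \<Theta> \<Longrightarrow> noms f \<subseteq> branch_noms \<Theta>"
  by (auto simp: branch_noms_def)

lemma accessibility_append: "accessibility \<Theta> f \<Longrightarrow> accessibility (\<Theta> @ b) f"
  by (auto simp: accessibility_def)

lemma introduces_append: "introduces \<Theta> i j \<Longrightarrow> introduces (\<Theta> @ b) i j"
  by (auto simp: introduces_def)

text \<open>Invariants need an induction, which the coinductive \<open>extension\<close> does not
  offer; this is the inductive view of the finite branches, taken only after complete rule
  applications.\<close>

inductive reachable :: "fm \<Rightarrow> branch \<Rightarrow> bool" for f where
  start: "reachable f [(f, Other)]"
| extend: "reachable f \<Theta> \<Longrightarrow> step \<Theta> bs \<Longrightarrow> b \<in> set bs \<Longrightarrow> reachable f (\<Theta> @ b)"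

lemma reachable_root: "reachable f \<Theta> \<Longrightarrow> \<Theta> \<noteq> [] \<and> root_fm \<Theta> = f"
  by (induction rule: reachable.induct) (auto simp: root_fm_def)

text \<open>Only the diamond rule creates nominals or \<open>By_Dia\<close> origins, so in the
  arguments about nominals the nine other rules collapse into one case.\<close>

lemma rule_cases [consumes 2, case_names Diamond Other]:
  assumes "rule \<Theta> bs" "b \<in> set bs"
  obtains i \<phi> j where "At i (Dia \<phi>) \<in> fms \<Theta>" "\<not> accessibility \<Theta> (At i (Dia \<phi>))"
      "\<not> dia_applied \<Theta> (At i (Dia \<phi>))" "quasi_urfather \<Theta> i" "j \<notin> branch_noms \<Theta>"
      "b = [(At i (Dia (Nom j)), By_Dia (At i (Dia \<phi>)) j), (At j \<phi>, By_Dia (At i (Dia \<phi>)) j)]"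
  | "\<And>g f j. (g, By_Dia f j) \<notin> set b" "branch_noms b \<subseteq> branch_noms \<Theta>"
  using assms
proof (cases rule: rule.cases)
  case Diamond
  then show ?thesis using assms(2) that(1) by auto
qed (use assms(2) in \<open>auto intro!: that(2) simp: branch_noms_def fms_def, (force simp: antisym_fm_def)+\<close>)

section \<open>The quasi-subformula property\<close>

definition bodies :: "fm \<Rightarrow> branch \<Rightarrow> fm set" where
  "bodies \<phi> \<Theta> = subfms \<phi> \<union> (\<Union>j \<in> branch_noms \<Theta>. subfms (antisym_fm j))"

lemma bodies_append: "bodies \<phi> \<Theta> \<subseteq> bodies \<phi> (\<Theta> @ b)"
  by (auto simp: bodies_def)

lemma bodies_subfms: "f \<in> subfms g \<Longrightarrow> g \<in> bodies \<phi> \<Theta> \<Longrightarrow> f \<in> bodies \<phi> \<Theta>"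
  unfolding bodies_def by (blast intro: subfms_trans)

text \<open>Antisymmetry formulas contain no diamond. Hence the letters of addresses come from a set
  fixed by the root, although \<open>bodies\<close> grows with the branch.\<close>

lemma Dia_bodies: "Dia \<psi> \<in> bodies \<phi> \<Theta> \<Longrightarrow> \<psi> \<in> subfms \<phi>"
  by (auto simp: bodies_def subfms_antisym_fm antisym_fm_def intro: subfms_trans[of \<psi> "Dia \<psi>"])

text \<open>The body \<open>Dia (Nom j)\<close> of an accessibility formula may lie outside
  \<open>bodies\<close>, hence the second disjunct. It does no harm, since the diamond and identity
  rules exclude accessibility formulas as premises.\<close>

definition well_formed :: "fm \<Rightarrow> branch \<Rightarrow> fm \<Rightarrow> bool" where
  "well_formed \<phi> \<Theta> f \<longleftrightarrow>
     (\<exists>k \<psi>. f = At k \<psi> \<and> (\<psi> \<in> bodies \<phi> \<Theta> \<or> accessibility \<Theta> f))"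

lemma well_formed_append: "well_formed \<phi> \<Theta> f \<Longrightarrow> well_formed \<phi> (\<Theta> @ b) f"
  using bodies_append accessibility_append unfolding well_formed_def by blast

lemma well_formed_At:
  "well_formed \<phi> \<Theta> (At k \<psi>) \<longleftrightarrow> \<psi> \<in> bodies \<phi> \<Theta> \<or> accessibility \<Theta> (At k \<psi>)"
  by (auto simp: well_formed_def)

lemma rule_well_formed:
  assumes "rule \<Theta> bs" "b \<in> set bs" "f \<in> fms b" and wf: "\<And>f. f \<in> fms \<Theta> \<Longrightarrow> well_formed \<phi> \<Theta> f"
  shows "well_formed \<phi> (\<Theta> @ b) f"
proof -
  have in_bodies: "\<psi> \<in> bodies \<phi> \<Theta>"
    if "At k \<psi> \<in> fms \<Theta>" "\<not> accessibility \<Theta> (At k \<psi>)" for k \<psi>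
    using wf[OF that(1)] that(2) by (simp add: well_formed_At)
  have not_acc: "\<not> accessibility \<Theta> (At k \<psi>)" if "\<And>j. \<psi> \<noteq> Dia (Nom j)" for k \<psi>
    using that by (auto simp: accessibility_def)
  have wfI: "well_formed \<phi> (\<Theta> @ b) (At k \<psi>)" if "\<psi> \<in> bodies \<phi> \<Theta>" for k \<psi>
    using that bodies_append by (auto simp: well_formed_At)
  \<comment> \<open>A premise whose body is not of the form \<open>Dia (Nom j)\<close> cannot be an
    accessibility formula, so its subformulas stay in \<open>bodies\<close>. In the
    \<open>Square\<close> and \<open>Trs\<close> cases the premise \<open>At i (Dia (Nom j))\<close>
    supplies only the prefix \<open>j\<close>.\<close>
  have sub: "well_formed \<phi> (\<Theta> @ b) (At l \<chi>)"
    if "At k \<psi> \<in> fms \<Theta>" "\<And>j. \<psi> \<noteq> Dia (Nom j)" "\<chi> \<in> subfms \<psi>" for k l \<psi> \<chi>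
    using that wfI bodies_subfms in_bodies not_acc by metis
  show ?thesis
    using assms(1)
  proof (cases rule: rule.cases)
    case (Eq i)
    \<comment> \<open>\<open>Nom i\<close> is a subformula of \<open>antisym_fm i\<close>, which
      also covers nominals foreign to the root.\<close>
    then have "Nom i \<in> bodies \<phi> \<Theta>" by (auto simp: bodies_def subfms_antisym_fm)
    then show ?thesis using Eq assms(2,3) wfI by (auto simp: fms_def)
  next
    case (And i \<phi> \<psi>)
    then show ?thesis using assms(2,3) sub[OF And(2)] by (auto simp: fms_def)
  next
    case (Or i \<phi> \<psi>)
    then show ?thesis using assms(2,3) sub[OF Or(2)] by (auto simp: fms_def)
  next
    case (Diamond i \<psi> j)
    have "\<psi> \<in> bodies \<phi> \<Theta>" using bodies_subfms[OF _ in_bodies[OF Diamond(2,3)], of \<psi>] by simp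
    moreover have "accessibility (\<Theta> @ b) (At i (Dia (Nom j)))"
      using Diamond assms(2) by (auto simp: accessibility_def)
    ultimately show ?thesis using Diamond assms(2,3) wfI by (auto simp: fms_def well_formed_At)
  next
    case (Square i \<psi> j)
    then show ?thesis using assms(2,3) sub[OF Square(2)] by (auto simp: fms_def)
  next
    case (Satisfaction i j \<psi>)
    then show ?thesis using assms(2,3) sub[OF Satisfaction(2)] by (auto simp: fms_def)
  next
    case (Id i \<psi> j)
    then show ?thesis using assms(2,3) in_bodies wfI by (auto simp: fms_def)
  next
    case (Ref i)
    then show ?thesis using assms(2,3) by (auto simp: fms_def well_formed_At accessibility_def)
  next
    case (A_sym i)
    then have "antisym_fm i \<in> bodies \<phi> \<Theta>" unfolding bodies_def using subfms_refl by blast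
    then show ?thesis using A_sym assms(2,3) wfI by (auto simp: fms_def)
  next
    case (Trs i \<psi> j)
    then show ?thesis using assms(2,3) sub[OF Trs(2)] by (auto simp: fms_def)
  qed
qed

lemma reachable_well_formed:
  "reachable (At r \<phi>) \<Theta> \<Longrightarrow> f \<in> fms \<Theta> \<Longrightarrow> well_formed \<phi> \<Theta> f"
proof (induction arbitrary: f rule: reachable.induct)
  case start
  then show ?case by (auto simp: fms_def well_formed_def bodies_def)
next
  case (extend \<Theta> bs b)
  then show ?case
    using rule_well_formed[of \<Theta> bs b f \<phi>] by (auto simp: step_def intro: well_formed_append)
qed

section \<open>Introduced nominals and their ancestors\<close>

lemma reachable_By_Dia:
  "reachable (At r \<phi>) \<Theta> \<Longrightarrow> (g, By_Dia f j) \<in> set \<Theta> \<Longrightarrow> f \<in> fms \<Theta> \<and> j \<in> branch_noms \<Theta>"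
proof (induction arbitrary: g f j rule: reachable.induct)
  case start
  then show ?case by simp
next
  case (extend \<Theta> bs b)
  show ?case
  proof (cases "(g, By_Dia f j) \<in> set \<Theta>")
    case True
    then show ?thesis using extend.IH by auto
  next
    case False
    then have *: "(g, By_Dia f j) \<in> set b" using extend.prems by simp
    have "rule \<Theta> bs" using extend.hyps by (simp add: step_def)
    then show ?thesis using extend.hyps(3)
      by (cases rule: rule_cases) (use * in \<open>auto simp: branch_noms_def fms_def\<close>)
  qed
qed

lemma reachable_introduces:
  assumes "reachable (At r \<phi>) \<Theta>" "introduces \<Theta> i j"
  shows "i \<in> branch_noms \<Theta> \<and> j \<in> branch_noms \<Theta>"
  using assms reachable_By_Dia noms_branch by (fastforce simp: introduces_def)

definition ancestors :: "branch \<Rightarrow> nom \<Rightarrow> nom set" where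
  "ancestors \<Theta> i = {k. (introduces \<Theta>)\<^sup>*\<^sup>* k i}"

lemma ancestors_refl [simp]: "i \<in> ancestors \<Theta> i"
  by (simp add: ancestors_def)

lemma ancestors_append: "ancestors \<Theta> i \<subseteq> ancestors (\<Theta> @ b) i"
  unfolding ancestors_def
  using rtranclp_mono[of "introduces \<Theta>" "introduces (\<Theta> @ b)"] introduces_append by blast

lemma ancestors_subset:
  assumes "reachable (At r \<phi>) \<Theta>" "i \<in> branch_noms \<Theta>"
  shows "ancestors \<Theta> i \<subseteq> branch_noms \<Theta>"
proof
  fix k assume "k \<in> ancestors \<Theta> i"
  then have "(introduces \<Theta>)\<^sup>*\<^sup>* k i" by (simp add: ancestors_def)
  \<comment> \<open>Splitting off the first edge suffices: \<open>k\<close> is \<open>i\<close>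
    itself or introduces some nominal, and either way it lies on the branch.\<close>
  then show "k \<in> branch_noms \<Theta>"
    by (cases rule: converse_rtranclpE) (use assms reachable_introduces in auto)
qed

text \<open>A finite set containing every \<open>T_set\<close>. It depends on the root alone because
  \<open>T2\<close> admits antisymmetry formulas only for nominals of the root.\<close>

definition label_set :: "fm \<Rightarrow> fm set" where
  "label_set f = \<Union> (subfms ` ({f} \<union> antisym_fm ` noms f))"

lemma finite_label_set [simp]: "finite (label_set f)"
  by (simp add: label_set_def)

lemma T_set_subset:
  assumes "root_fm \<Theta> = At r \<phi>"
  shows "T_set \<Theta> i \<subseteq> label_set (At r \<phi>)"
  using assms by (auto simp: T_set_def T1_def T2_def prefixed_subfm_def label_set_def)

text \<open>Distinct ancestors of a quasi-urfather are never twins, so \<open>T_set\<close> maps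
  them injectively into the subsets of \<open>label_set\<close>.\<close>

lemma card_ancestors_quasi_urfather:
  assumes "root_fm \<Theta> = At r \<phi>" "quasi_urfather \<Theta> i"
  shows "card (ancestors \<Theta> i) \<le> 2 ^ card (label_set (At r \<phi>))"
proof -
  have "inj_on (T_set \<Theta>) (ancestors \<Theta> i)"
    using assms(2) by (auto simp: inj_on_def quasi_urfather_def twins_def ancestors_def)
  then have "card (ancestors \<Theta> i) \<le> card (Pow (label_set (At r \<phi>)))"
    by (rule card_inj_on_le) (use T_set_subset[OF assms(1)] in auto)
  then show ?thesis by (simp add: card_Pow)
qed

section \<open>Addresses of nominals\<close>

type_synonym address = "nom \<times> fm list"

definition addresses :: "nom \<Rightarrow> fm \<Rightarrow> address set" where
  "addresses r \<phi> =
     noms (At r \<phi>) \<times> {\<psi>s. set \<psi>s \<subseteq> subfms \<phi> \<and> length \<psi>s \<le> 2 ^ card (label_set (At r \<phi>))}"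

lemma finite_addresses: "finite (addresses r \<phi>)"
  unfolding addresses_def by (intro finite_cartesian_product finite_lists_length_le) auto

text \<open>The third clause turns a bound on ancestors into a bound on address length; it is strict
  because a nominal is its own ancestor. The fourth recovers from a nonempty address the diamond
  application that created the nominal, which is what keeps \<open>c\<close> injective.\<close>

definition addressing :: "nom \<Rightarrow> fm \<Rightarrow> branch \<Rightarrow> (nom \<Rightarrow> address) \<Rightarrow> bool" where
  "addressing r \<phi> \<Theta> c \<longleftrightarrow>
     inj_on c (branch_noms \<Theta>) \<and> c ` branch_noms \<Theta> \<subseteq> addresses r \<phi> \<and>
     (\<forall>j \<in> branch_noms \<Theta>. length (snd (c j)) < card (ancestors \<Theta> j)) \<and>
     (\<forall>j \<in> branch_noms \<Theta>. snd (c j) = [] \<or>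
        (\<exists>g i \<psi>. (g, By_Dia (At i (Dia \<psi>)) j) \<in> set \<Theta> \<and> c j = (fst (c i), \<psi> # snd (c i))))"

lemma addressing_Diamond:
  assumes reach: "reachable (At r \<phi>) \<Theta>" and c: "addressing r \<phi> \<Theta> c"
    and prem: "At i (Dia \<psi>) \<in> fms \<Theta>" "\<not> accessibility \<Theta> (At i (Dia \<psi>))"
      "\<not> dia_applied \<Theta> (At i (Dia \<psi>))" "quasi_urfather \<Theta> i" "j \<notin> branch_noms \<Theta>"
    and b: "b = [(At i (Dia (Nom j)), By_Dia (At i (Dia \<psi>)) j), (At j \<psi>, By_Dia (At i (Dia \<psi>)) j)]"
    and reach': "reachable (At r \<phi>) (\<Theta> @ b)"
  shows "addressing r \<phi> (\<Theta> @ b) (c(j := (fst (c i), \<psi> # snd (c i))))"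
    (is "addressing r \<phi> ?\<Theta> ?c")
proof -
  note c = c[unfolded addressing_def]
  have i: "i \<in> branch_noms \<Theta>" and "noms \<psi> \<subseteq> branch_noms \<Theta>"
    using noms_branch[OF prem(1)] by auto
  then have noms: "branch_noms ?\<Theta> = insert j (branch_noms \<Theta>)"
    by (auto simp: b branch_noms_def fms_def)
  have old: "?c k = c k" if "k \<in> branch_noms \<Theta>" for k
    using that prem(5) by auto
  \<comment> \<open>An old \<open>k\<close> with this address would come from a diamond application
    at some \<open>l\<close> with the same body and \<open>c l = c i\<close>. Injectivity gives
    \<open>l = i\<close>, so the rule would already have been applied to this very formula.\<close>
  have fresh: "c k \<noteq> (fst (c i), \<psi> # snd (c i))" if k: "k \<in> branch_noms \<Theta>" for k
  proof
    assume eq: "c k = (fst (c i), \<psi> # snd (c i))"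
    then obtain g l \<chi> where l: "(g, By_Dia (At l (Dia \<chi>)) k) \<in> set \<Theta>"
      "c k = (fst (c l), \<chi> # snd (c l))"
      using c k by fastforce
    have "c l = c i" "\<chi> = \<psi>" using eq l(2) by (auto simp: prod_eq_iff)
    moreover have "l \<in> branch_noms \<Theta>"
      using reachable_introduces[OF reach] l(1) by (auto simp: introduces_def)
    ultimately have "l = i" using c i by (auto dest: inj_onD)
    then show False using l(1) \<open>\<chi> = \<psi>\<close> prem(3) by (auto simp: dia_applied_def)
  qed
  have "inj_on ?c (branch_noms ?\<Theta>)"
    using c fresh prem(5) unfolding noms inj_on_def by (auto split: if_splits) metis+
  moreover have "?c ` branch_noms ?\<Theta> \<subseteq> addresses r \<phi>"
  proof -
    have "\<psi> \<in> subfms \<phi>"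
      using reachable_well_formed[OF reach prem(1)] prem(2) Dia_bodies by (simp add: well_formed_At)
    \<comment> \<open>The strict inequality for the parent leaves room for the one additional
      entry.\<close>
    moreover have "length (snd (c i)) < 2 ^ card (label_set (At r \<phi>))"
      using c i card_ancestors_quasi_urfather[OF _ prem(4)] reachable_root[OF reach]
      by (meson less_le_trans)
    moreover have "c i \<in> addresses r \<phi>" using c i by blast
    ultimately have "(fst (c i), \<psi> # snd (c i)) \<in> addresses r \<phi>"
      by (auto simp: addresses_def mem_Times_iff)
    then show ?thesis using c old noms by auto
  qed
  moreover have "length (snd (?c k)) < card (ancestors ?\<Theta> k)" if "k \<in> branch_noms ?\<Theta>" for k
  proof -
    \<comment> \<open>Since \<open>card\<close> is 0 on infinite sets, lower bounds on it need
      finiteness.\<close>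
    have fin: "finite (ancestors ?\<Theta> k)"
      using ancestors_subset[OF reach' that] finite_branch_noms finite_subset by blast
    show ?thesis
    proof (cases "k = j")
      case True
      have "introduces ?\<Theta> i j" by (auto simp: introduces_def b)
      then have "ancestors ?\<Theta> i \<subseteq> ancestors ?\<Theta> j"
        by (auto simp: ancestors_def intro: rtranclp.rtrancl_into_rtrancl)
      \<comment> \<open>Besides the ancestors of its parent, \<open>j\<close> has itself as an
        ancestor; this one more matches the one more list entry.\<close>
      then have "insert j (ancestors \<Theta> i) \<subseteq> ancestors ?\<Theta> j"
        using ancestors_append[of \<Theta> i b] by auto
      moreover have "finite (ancestors \<Theta> i)" "j \<notin> ancestors \<Theta> i"
        using ancestors_subset[OF reach i] finite_branch_noms finite_subset prem(5) by blast+
      ultimately have "Suc (card (ancestors \<Theta> i)) \<le> card (ancestors ?\<Theta> j)"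
        using card_mono[of "ancestors ?\<Theta> j" "insert j (ancestors \<Theta> i)"] fin True by simp
      then show ?thesis using True c i by fastforce
    next
      case False
      then have "k \<in> branch_noms \<Theta>" using that noms by blast
      then show ?thesis
        using c old card_mono[OF fin ancestors_append] by (metis less_le_trans)
    qed
  qed
  moreover have "snd (?c k) = [] \<or> (\<exists>g l \<chi>. (g, By_Dia (At l (Dia \<chi>)) k) \<in> set ?\<Theta> \<and>
      ?c k = (fst (?c l), \<chi> # snd (?c l)))" if "k \<in> branch_noms ?\<Theta>" for k
  proof (cases "k = j")
    case True
    then show ?thesis using old[OF i] by (fastforce simp: b)
  next
    case False
    then have k: "k \<in> branch_noms \<Theta>" using that noms by blast
    show ?thesis
    proof (cases "snd (c k) = []")
      case True
      then show ?thesis using old[OF k] by simp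
    next
      case False
      then obtain g l \<chi> where l: "(g, By_Dia (At l (Dia \<chi>)) k) \<in> set \<Theta>"
        "c k = (fst (c l), \<chi> # snd (c l))"
        using c k by blast
      \<comment> \<open>Thus \<open>l\<close> differs from the fresh \<open>j\<close>, and the
        update leaves its address unchanged.\<close>
      have "l \<in> branch_noms \<Theta>"
        using reachable_introduces[OF reach] l(1) by (auto simp: introduces_def)
      then show ?thesis using l old k by (metis UnCI set_append)
    qed
  qed
  ultimately show ?thesis unfolding addressing_def by blast
qed

lemma reachable_addressing: "reachable (At r \<phi>) \<Theta> \<Longrightarrow> \<exists>c. addressing r \<phi> \<Theta> c"
proof (induction rule: reachable.induct)
  case start
  \<comment> \<open>Initially nothing is introduced, so each nominal is its only ancestor and the
    empty list satisfies the strict length condition as 0 < 1.\<close>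
  have "introduces [(At r \<phi>, Other)] = (\<lambda>_ _. False)"
    by (auto simp: introduces_def fun_eq_iff)
  then have "ancestors [(At r \<phi>, Other)] k = {k}" for k
    by (auto simp: ancestors_def elim: rtranclp.cases)
  then have "addressing r \<phi> [(At r \<phi>, Other)] (\<lambda>k. (k, []))"
    by (auto simp: addressing_def addresses_def inj_on_def branch_noms_def fms_def)
  then show ?case by blast
next
  case (extend \<Theta> bs b)
  then obtain c where c: "addressing r \<phi> \<Theta> c" by blast
  have reach': "reachable (At r \<phi>) (\<Theta> @ b)" using extend.hyps reachable.extend by blast
  have "rule \<Theta> bs" using extend.hyps by (simp add: step_def)
  then show ?case
    using extend.hyps(3)
  proof (cases rule: rule_cases)
    case (Diamond i \<psi> j)
    then show ?thesis using addressing_Diamond[OF extend.hyps(1) c Diamond reach'] by blast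
  next
    case Other
    then have noms: "branch_noms (\<Theta> @ b) = branch_noms \<Theta>" by auto
    have "introduces (\<Theta> @ b) = introduces \<Theta>"
      using Other(1) by (auto simp: introduces_def fun_eq_iff)
    then have "ancestors (\<Theta> @ b) = ancestors \<Theta>" unfolding ancestors_def by simp
    then have "addressing r \<phi> (\<Theta> @ b) c"
      using c unfolding addressing_def noms by (metis UnCI set_append)
    then show ?thesis by blast
  qed
qed

section \<open>A bound on the formulas of a branch\<close>

definition fms_bound :: "nom \<Rightarrow> fm \<Rightarrow> nat" where
  "fms_bound r \<phi> = (let n = card (addresses r \<phi>) in n * (card (subfms \<phi>) + n * 6))"

text \<open>Injective addresses bound the nominals, hence the prefixes. Bodies are subformulas of
  \<open>\<phi>\<close> or belong to one of six shapes per nominal \<open>j\<close>: the five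
  subformulas of \<open>antisym_fm j\<close>, and \<open>Dia (Nom j)\<close> for accessibility
  formulas.\<close>

lemma card_fms_bound:
  assumes reach: "reachable (At r \<phi>) \<Theta>"
  shows "card (fms \<Theta>) \<le> fms_bound r \<phi>"
proof -
  let ?N = "branch_noms \<Theta>" and ?n = "card (addresses r \<phi>)"
  let ?A = "\<lambda>j. insert (Dia (Nom j)) (subfms (antisym_fm j))"
  let ?B = "subfms \<phi> \<union> \<Union> (?A ` ?N)"
  obtain c where "addressing r \<phi> \<Theta> c" using reachable_addressing[OF reach] by blast
  then have n: "card ?N \<le> ?n"
    unfolding addressing_def using card_inj_on_le finite_addresses by blast
  have "fms \<Theta> \<subseteq> (\<lambda>(k, \<psi>). At k \<psi>) ` (?N \<times> ?B)"
  proof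
    fix f assume f: "f \<in> fms \<Theta>"
    obtain k \<psi> where k: "f = At k \<psi>" "\<psi> \<in> bodies \<phi> \<Theta> \<or> accessibility \<Theta> f"
      using reachable_well_formed[OF reach f] by (auto simp: well_formed_def)
    \<comment> \<open>The second fact places the \<open>j\<close> of a body
      \<open>Dia (Nom j)\<close> among the branch nominals, where \<open>?A j\<close> covers
      it.\<close>
    have "k \<in> ?N" "noms \<psi> \<subseteq> ?N" using noms_branch[OF f] k(1) by auto
    moreover have "\<psi> \<in> bodies \<phi> \<Theta> \<or> (\<exists>j. \<psi> = Dia (Nom j))"
      using k by (auto simp: accessibility_def)
    ultimately show "f \<in> (\<lambda>(k, \<psi>). At k \<psi>) ` (?N \<times> ?B)"
      unfolding k(1) bodies_def by force
  qed
  then have "card (fms \<Theta>) \<le> card (?N \<times> ?B)"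
    by (intro surj_card_le) auto
  also have "\<dots> = card ?N * card ?B" by (rule card_cartesian_product)
  also have "\<dots> \<le> ?n * (card (subfms \<phi>) + ?n * 6)"
  proof (rule mult_le_mono[OF n])
    have "card (?A j) \<le> 6" for j
      by (simp add: subfms_antisym_fm card_insert_if)
    then have "card (\<Union> (?A ` ?N)) \<le> card ?N * 6"
      by (intro order_trans[OF card_UN_le] order_trans[OF sum_bounded_above]) auto
    then show "card ?B \<le> card (subfms \<phi>) + ?n * 6"
      using card_Un_le[of "subfms \<phi>" "\<Union> (?A ` ?N)"] n by linarith
  qed
  finally show ?thesis by (simp add: fms_bound_def Let_def)
qed

section \<open>From bounded branches to finite trees\<close>

lemma finite_nodes_Node:
  assumes "\<And>u. u \<in> set us \<Longrightarrow> finite (nodes u)"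
  shows "finite (nodes (Node x us))"
proof -
  have "nodes (Node x us) \<subseteq> insert [] (\<Union>n < length us. (#) n ` nodes (us ! n))"
  proof
    fix p assume "p \<in> nodes (Node x us)"
    then show "p \<in> insert [] (\<Union>n < length us. (#) n ` nodes (us ! n))"
      by (cases p) (auto simp: nodes_def)
  qed
  moreover have "finite \<dots>" using assms by simp
  ultimately show ?thesis by (rule finite_subset)
qed

lemma finite_nodes_thread:
  assumes "\<And>u. u \<in> set us \<Longrightarrow> finite (nodes u)"
  shows "u \<in> set (thread b us) \<Longrightarrow> finite (nodes u)"
  using assms by (induction b arbitrary: u) (auto intro: finite_nodes_Node)

text \<open>Each step adds a formula to every branch it produces, so the gap between the number of
  formulas and \<open>fms_bound\<close> is a decreasing measure. Induction on it replaces induction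
  on the possibly infinite tree.\<close>

lemma finite_nodes_extension:
  assumes "reachable (At r \<phi>) \<Theta>" "extension \<Theta> ts" "t \<in> set ts"
  shows "finite (nodes t)"
  using assms
proof (induction "fms_bound r \<phi> - card (fms \<Theta>)" arbitrary: \<Theta> ts t rule: less_induct)
  case less
  from less.prems(2) show ?case
  proof (cases rule: extension.cases)
    case Stop
    then show ?thesis using less.prems(3) by simp
  next
    case (Extend bs uss)
    obtain b us where bus: "(b, us) \<in> set (zip bs uss)" "t \<in> set (thread b us)"
      using less.prems(3) Extend(1) by auto
    then have b: "b \<in> set bs" and ext: "extension (\<Theta> @ b) us"
      using Extend(3) by (auto simp: list_all2_iff dest: set_zip_leftD)
    have reach: "reachable (At r \<phi>) (\<Theta> @ b)"
      using less.prems(1) Extend(2) b by (rule reachable.extend)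
    have "fms \<Theta> \<subset> fms (\<Theta> @ b)" using Extend(2) b by (auto simp: step_def)
    then have "card (fms \<Theta>) < card (fms (\<Theta> @ b))" by (simp add: psubset_card_mono)
    \<comment> \<open>Subtraction is truncated, so the decrease relies on the bound for the extended
      branch.\<close>
    then have "fms_bound r \<phi> - card (fms (\<Theta> @ b)) < fms_bound r \<phi> - card (fms \<Theta>)"
      using card_fms_bound[OF reach] by linarith
    then have "finite (nodes u)" if "u \<in> set us" for u
      using less.hyps reach ext that by blast
    then show ?thesis using bus(2) by (rule finite_nodes_thread)
  qed
qed

theorem theorem5p4:
  fixes \<phi> :: fm and i :: nom and t :: "entry tree"
  assumes "i \<notin> noms \<phi>"
    and "tableau (At i (nnf \<phi>)) t"
  shows "finite (nodes t)"
proof -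
  have t: "t = Node (At i (nnf \<phi>), Other) (children t)"
    and ext: "extension [(At i (nnf \<phi>), Other)] (children t)"
    using assms(2) by (metis tableau_def tree.collapse)+
  have "finite (nodes u)" if "u \<in> set (children t)" for u
    using finite_nodes_extension[OF reachable.start ext that] .
  then show ?thesis by (subst t) (rule finite_nodes_Node)
qed

end
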